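(* For constant $k$, there is a reduction from $k$-Clique to $k$-DSP on unweighted DAGs with $O((kn)^2)$ vertices that runs in $O((kn)^2)$ time; that is, given an instance $G$ of $k$-Clique, one can construct in $O((kn)^2)$ time an unweighted DAG $G'$ with $O((kn)^2)$ vertices and sources $s_1,\dots,s_k$, targets $t_1,\dots,t_k$, such that $G$ contains a $k$-clique if and only if $G'$ contains pairwise internally vertex-disjoint paths $P_1,\dots,P_k$ with each $P_i$ a shortest $(s_i,t_i)$-path.
   Context: In the $k$-Clique problem, the input is a $k$-partite graph $G$ with vertex set $V_1\sqcup\cdots\sqcup V_k$ where each part $V_i$ has $n$ vertices, and the task is to decide whether $G$ contains a $k$-clique (a set of $k$ mutually adjacent vertices). In $k$-DSP, given a graph with positive edge weights (unweighted means all weights equal $1$), sources $s_1,\dots,s_k$ and targets $t_1,\dots,t_k$, one must decide whether there exist pairwise internally vertex-disjoint paths $P_1,\dots,P_k$ with each $P_i$ a shortest $(s_i,t_i)$-path. *)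

theory Defs
  imports "Graph_Theory.Graph_Theory" "HOL-Library.Log_Nat"
begin

section \<open>Cliques in k-partite graphs\<close>

text \<open>
  The vertices are \<open>{..<k * n}\<close>, and part \<open>i < k\<close> is the block \<open>{i * n..<(i + 1) * n}\<close>, so that
  \<open>u div n\<close> is the part of \<open>u\<close>. A \<open>pair_graph\<close> is a finite simple undirected graph,
  represented by its symmetric, irreflexive set of ordered pairs.
\<close>

definition kpartite_graph :: "nat \<Rightarrow> nat \<Rightarrow> nat pair_pre_digraph \<Rightarrow> bool" where
  "kpartite_graph k n G \<longleftrightarrow> pair_graph G \<and> pverts G = {..<k * n} \<and>
     (\<forall>(u, v) \<in> parcs G. u div n \<noteq> v div n)"

definition has_clique :: "'a pair_pre_digraph \<Rightarrow> nat \<Rightarrow> bool" where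
  "has_clique G k \<longleftrightarrow> (\<exists>X \<subseteq> pverts G. finite X \<and> card X = k \<and>
     (\<forall>u \<in> X. \<forall>v \<in> X. u \<noteq> v \<longrightarrow> (u, v) \<in> parcs G))"


section \<open>Disjoint shortest paths\<close>

context wf_digraph
begin

definition shortest_apath :: "'b weight_fun \<Rightarrow> 'a \<Rightarrow> 'b awalk \<Rightarrow> 'a \<Rightarrow> bool" where
  "shortest_apath f u p v \<longleftrightarrow> apath u p v \<and> ereal (awalk_cost f p) = \<mu> f u v"

text \<open>
  Internal vertices of one path may not occur anywhere on another path; endpoints may be shared.
\<close>

definition disjoint_shortest_paths ::
    "'b weight_fun \<Rightarrow> nat \<Rightarrow> (nat \<Rightarrow> 'a) \<Rightarrow> (nat \<Rightarrow> 'a) \<Rightarrow> bool" where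
  "disjoint_shortest_paths f k s t \<longleftrightarrow>
     (\<exists>P. (\<forall>i<k. shortest_apath f (s i) (P i) (t i)) \<and>
          (\<forall>i<k. \<forall>j<k. i \<noteq> j \<longrightarrow>
             set (inner_verts (P i)) \<inter> set (awalk_verts (s j) (P j)) = {}))"

end

definition dag :: "'a pair_pre_digraph \<Rightarrow> bool" where
  "dag H \<longleftrightarrow> pair_digraph H \<and> acyclic (parcs H)"


section \<open>Machine model\<close>

text \<open>
  A structured word RAM. A program uses finitely many arrays of machine words, named by natural
  numbers; \<open>Get a e\<close> reads array \<open>a\<close> at the computed index \<open>e\<close>, and entry 0 of an array can serve
  as a scalar variable. Interleaving the arrays of a fixed program simulates it on a
  single-memory word RAM with constant overhead. For word length \<open>w\<close>, every value occurring
  in the evaluation of an expression, including every array index, has to be less than \<open>2 ^ w\<close>;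
  otherwise the program is stuck, so the \<open>exec\<close> relation contains overflow-free, terminating runs
  only. Each constant, array access, arithmetic operation, assignment and test costs one unit.
\<close>

datatype bop = Add | Sub | Mul | Div | Mod

datatype aexp = Const nat | Get nat aexp | Bop bop aexp aexp

datatype com =
    Skip
  | Put nat aexp aexp
  | Seq com com
  | If aexp com com
  | While aexp com

type_synonym store = "nat \<Rightarrow> nat \<Rightarrow> nat"

text \<open>\<open>Sub\<close> is truncated subtraction, and \<open>x div 0 = 0\<close>, \<open>x mod 0 = x\<close> as in HOL.\<close>

fun bop_val :: "bop \<Rightarrow> nat \<Rightarrow> nat \<Rightarrow> nat" where
  "bop_val Add x y = x + y"
| "bop_val Sub x y = x - y"
| "bop_val Mul x y = x * y"
| "bop_val Div x y = x div y"
| "bop_val Mod x y = x mod y"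

fun aval :: "aexp \<Rightarrow> store \<Rightarrow> nat" where
  "aval (Const c) S = c"
| "aval (Get a e) S = S a (aval e S)"
| "aval (Bop b e1 e2) S = bop_val b (aval e1 S) (aval e2 S)"

fun acost :: "aexp \<Rightarrow> nat" where
  "acost (Const c) = 1"
| "acost (Get a e) = acost e + 1"
| "acost (Bop b e1 e2) = acost e1 + acost e2 + 1"

fun fits :: "nat \<Rightarrow> aexp \<Rightarrow> store \<Rightarrow> bool" where
  "fits w (Const c) S \<longleftrightarrow> c < 2 ^ w"
| "fits w (Get a e) S \<longleftrightarrow> fits w e S \<and> S a (aval e S) < 2 ^ w"
| "fits w (Bop b e1 e2) S \<longleftrightarrow> fits w e1 S \<and> fits w e2 S \<and> bop_val b (aval e1 S) (aval e2 S) < 2 ^ w"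

text \<open>
  \<open>exec w c S T S'\<close>: with word length \<open>w\<close>, program \<open>c\<close> started in store \<open>S\<close> halts after time \<open>T\<close>
  in store \<open>S'\<close>. A nonzero value counts as true.
\<close>

inductive exec :: "nat \<Rightarrow> com \<Rightarrow> store \<Rightarrow> nat \<Rightarrow> store \<Rightarrow> bool" for w :: nat where
  Skip: "exec w Skip S 1 S"
| Put: "fits w i S \<Longrightarrow> fits w e S \<Longrightarrow>
    exec w (Put a i e) S (acost i + acost e + 1) (S(a := (S a)(aval i S := aval e S)))"
| Seq: "exec w c1 S T1 S1 \<Longrightarrow> exec w c2 S1 T2 S2 \<Longrightarrow> exec w (Seq c1 c2) S (T1 + T2) S2"
| IfTrue: "fits w e S \<Longrightarrow> aval e S \<noteq> 0 \<Longrightarrow> exec w c1 S T S' \<Longrightarrow>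
    exec w (If e c1 c2) S (acost e + 1 + T) S'"
| IfFalse: "fits w e S \<Longrightarrow> aval e S = 0 \<Longrightarrow> exec w c2 S T S' \<Longrightarrow>
    exec w (If e c1 c2) S (acost e + 1 + T) S'"
| WhileFalse: "fits w e S \<Longrightarrow> aval e S = 0 \<Longrightarrow> exec w (While e c) S (acost e + 1) S"
| WhileTrue: "fits w e S \<Longrightarrow> aval e S \<noteq> 0 \<Longrightarrow> exec w c S T1 S1 \<Longrightarrow>
    exec w (While e c) S1 T2 S2 \<Longrightarrow> exec w (While e c) S (acost e + 1 + T1 + T2) S2"

inductive_cases exec_elims:
  "exec w Skip S T S'"
  "exec w (Put a i e) S T S'"
  "exec w (Seq c1 c2) S T S'"
  "exec w (If e c1 c2) S T S'"
  "exec w (While e c) S T S'"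

lemma exec_deterministic:
  "exec w c S T S' \<Longrightarrow> exec w c S U S'' \<Longrightarrow> T = U \<and> S' = S''"
proof (induction arbitrary: U S'' rule: exec.induct)
  case (Skip S)
  then show ?case by (rule exec_elims(1)) simp
next
  case (Put i S e a)
  from Put.prems show ?case by (rule exec_elims(2)) simp
next
  case (Seq c1 S T1 S1 c2 T2 S2)
  from Seq.prems obtain U1 S1' U2 where
    "exec w c1 S U1 S1'" "exec w c2 S1' U2 S''" "U = U1 + U2"
    by (rule exec_elims(3))
  with Seq.IH show ?case by metis
next
  case (IfTrue e S c1 T S' c2)
  from IfTrue.prems IfTrue.hyps(2) obtain U1 where
    "exec w c1 S U1 S''" "U = acost e + 1 + U1"
    by - (erule exec_elims(4), simp_all)
  with IfTrue.IH show ?case by metis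
next
  case (IfFalse e S c2 T S' c1)
  from IfFalse.prems IfFalse.hyps(2) obtain U1 where
    "exec w c2 S U1 S''" "U = acost e + 1 + U1"
    by - (erule exec_elims(4), simp_all)
  with IfFalse.IH show ?case by metis
next
  case (WhileFalse e S c)
  from WhileFalse.prems WhileFalse.hyps(2) show ?case
    by - (erule exec_elims(5), simp_all)
next
  case (WhileTrue e S c T1 S1 T2 S2)
  from WhileTrue.prems WhileTrue.hyps(2) obtain U1 S1' U2 where
    "exec w c S U1 S1'" "exec w (While e c) S1' U2 S''" "U = acost e + 1 + U1 + U2"
    by - (erule exec_elims(5), simp_all)
  with WhileTrue.IH show ?case by metis
qed


section \<open>Input and output encodings\<close>

text \<open>
  The input is \<open>k\<close>, \<open>n\<close> and the adjacency matrix in row-major order; all other words are zero.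
\<close>

definition clique_input :: "nat \<Rightarrow> nat \<Rightarrow> nat pair_pre_digraph \<Rightarrow> store" where
  "clique_input k n G = (\<lambda>_ _. 0)
     (0 := (\<lambda>_. 0)(0 := k),
      1 := (\<lambda>_. 0)(0 := n),
      2 := (\<lambda>x. if x < (k * n)\<^sup>2 \<and> (x div (k * n), x mod (k * n)) \<in> parcs G then 1 else 0))"

text \<open>
  The output graph is given by its number of vertices (array 3), the length of its arc list
  (array 4), and the tails and heads in this list (arrays 5 and 6); the terminals
  are in arrays 7 and 8. Repetitions in the arc list are harmless.
\<close>

definition dsp_output :: "nat \<Rightarrow> store \<Rightarrow> nat pair_pre_digraph \<Rightarrow> (nat \<Rightarrow> nat) \<Rightarrow> (nat \<Rightarrow> nat) \<Rightarrow> bool" where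
  "dsp_output k S H s t \<longleftrightarrow>
     pverts H = {..<S 3 0} \<and>
     parcs H = (\<lambda>x. (S 5 x, S 6 x)) ` {..<S 4 0} \<and>
     (\<forall>i<k. s i = S 7 i \<and> t i = S 8 i)"

end

theory Submission
  imports Defs
begin

text \<open>
  Every vertex \<open>y\<close> of \<open>G\<close> becomes an L-shaped line: a row at height \<open>y\<close> running to the diagonal,
  followed by a column at abscissa \<open>y\<close>. Any two lines cross exactly once. The crossing of two lines
  from different parts is merged into a single vertex iff the two vertices are not adjacent in \<open>G\<close>,
  and the lines of part \<open>i\<close> share their first vertex \<open>s\<^sub>i\<close> and their last vertex \<open>t\<^sub>i\<close>. If the
  shortest \<open>(s\<^sub>i, t\<^sub>i)\<close>-paths are exactly the lines of part \<open>i\<close>, then disjoint shortest paths are the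
  same as pairwise adjacent vertices, one from each part.

  A path may change lines at a merged vertex. To make this unprofitable, the position \<open>\<tau>\<close> along each
  line \<open>y\<close> is calibrated so that turning from a row into a column lowers \<open>\<tau> + y\<close> by \<open>n\<close>, and turning
  from a column into a row raises it by \<open>n\<close>. Hence a path from line \<open>v\<close> to line \<open>w\<close>
  that uses \<open>d\<close> of the bends on the diagonal
  is longer than a line by \<open>(w - v) + n * (1 - d)\<close>. Between \<open>s\<^sub>i\<close> and \<open>t\<^sub>i\<close> we have \<open>\<bar>w - v\<bar> < n\<close> and
  \<open>d \<le> 1\<close>, and \<open>d = 1\<close> forces \<open>w \<ge> v\<close>, with equality only for the line itself. The \<open>k * n\<close> lines
  have length \<open>2 * k * n\<close>, and the arc at each position is a closed expression in \<open>k\<close>, \<open>n\<close> and two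
  entries of the adjacency matrix, so that a single loop writes the graph.
\<close>

section \<open>The line arrangement\<close>

locale line_arrangement =
  fixes k n :: nat and E :: "(nat \<times> nat) set"
  assumes k_pos: "1 \<le> k" and n_pos: "1 \<le> n"
begin

definition N :: nat where "N = k * n"

definition base :: "nat \<Rightarrow> nat" where "base y = y div n * n"

text \<open>
  Line \<open>y\<close> is a row at the times \<open>\<tau> < 2 * base y\<close> and a column afterwards. As a row it passes
  column \<open>u < base y\<close> at its time \<open>u + base y\<close>, which is time \<open>y + base y - n\<close> of line \<open>u\<close>.
  The vertices of a merged crossing are represented on the column.
\<close>

definition merged :: "nat \<Rightarrow> nat \<Rightarrow> bool" where
  "merged y \<tau> \<longleftrightarrow> base y \<le> \<tau> \<and> \<tau> < 2 * base y \<and> (\<tau> - base y, y) \<notin> E"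

text \<open>Positions range over \<open>0..2 * N\<close>, hence the radix \<open>2 * N + 1\<close>.
  All codes are vertices of \<open>grid\<close>; those displaced by merging or by shared ends are
  isolated.\<close>

definition code :: "nat \<Rightarrow> nat \<Rightarrow> nat" where
  "code a b = a * (2 * N + 1) + b"

definition node :: "nat \<Rightarrow> nat \<Rightarrow> nat" where
  "node y \<tau> =
     (if \<tau> = 0 \<or> \<tau> = 2 * N then code (base y) \<tau>
      else if merged y \<tau> then code (\<tau> - base y) (y + base y - n)
      else code y \<tau>)"

definition line :: "nat \<Rightarrow> nat \<Rightarrow> (nat \<times> nat) list" where
  "line y m = map (\<lambda>\<tau>. (node y \<tau>, node y (Suc \<tau>))) [0..<m]"

definition grid :: "nat pair_pre_digraph" where
  "grid = \<lparr>pverts = {..<N * (2 * N + 1)},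
     parcs = {(node y \<tau>, node y (Suc \<tau>)) | y \<tau>. y < N \<and> \<tau> < 2 * N}\<rparr>"

section \<open>Arithmetic of blocks and vertex codes\<close>

lemma N_pos: "0 < N"
  using k_pos n_pos by (simp add: N_def)

lemma base_le: "base y \<le> y"
  by (simp add: base_def)

lemma less_base_add: "y < base y + n"
  using n_pos mod_less_divisor[of n y] div_mult_mod_eq[of y n] unfolding base_def by linarith

lemma base_mono: "y \<le> z \<Longrightarrow> base y \<le> base z"
  by (simp add: base_def div_le_mono)

lemma base_add_le_base:
  assumes "base y < base z" shows "base y + n \<le> base z"
proof -
  have "y div n < z div n"
    using assms by (simp add: base_def)
  then have "(y div n + 1) * n \<le> z div n * n"
    by (intro mult_le_mono1) simp
  then show ?thesis by (simp add: base_def)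
qed

lemma less_base_add_le: "u < base y \<Longrightarrow> base u + n \<le> base y"
  using base_le[of u] base_add_le_base[of u y] by linarith

lemma base_add_le_N:
  assumes "y < N" shows "base y + n \<le> N"
proof -
  have "y div n < k"
    using assms by (simp add: N_def less_mult_imp_div_less)
  then have "(y div n + 1) * n \<le> k * n"
    by (intro mult_le_mono1) simp
  then show ?thesis by (simp add: base_def N_def)
qed

text \<open>The hypothesis makes \<open>base y\<close> a positive multiple of \<open>n\<close>; this
  keeps the truncated difference \<open>y + base y - n\<close> exact.\<close>

lemma le_base: "\<tau> < 2 * base y \<Longrightarrow> n \<le> base y"
  using base_add_le_base[of 0 y] by (cases "base y = 0") (simp_all add: base_def[of 0])

lemma code_div_mod:
  assumes "b \<le> 2 * N"
  shows "code a b div (2 * N + 1) = a" "code a b mod (2 * N + 1) = b"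
  using assms by (simp_all only: code_def div_mult_self3 mod_mult_self3 less_Suc_eq_le Suc_eq_plus1[symmetric]
      div_less mod_less)

lemma code_eq_iff: "b \<le> 2 * N \<Longrightarrow> d \<le> 2 * N \<Longrightarrow> code a b = code c d \<longleftrightarrow> a = c \<and> b = d"
  using code_div_mod by metis

lemma code_less:
  assumes "a < N" "b \<le> 2 * N"
  shows "code a b < N * (2 * N + 1)"
proof -
  have "(a + 1) * (2 * N + 1) \<le> N * (2 * N + 1)"
    using assms(1) by (intro mult_le_mono1) simp
  with assms(2) show ?thesis by (simp add: code_def)
qed

lemma merged_bounds:
  assumes "merged y \<tau>" "y < N"
  shows "\<tau> - base y < base y" "0 < y + base y - n" "y + base y - n < 2 * N" "\<tau> < 2 * N" "0 < \<tau>"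
  using assms base_le[of y] le_base[of \<tau> y] base_add_le_N[of y] n_pos
  unfolding merged_def by linarith+

lemma node_less:
  assumes "y < N" "\<tau> \<le> 2 * N"
  shows "node y \<tau> < N * (2 * N + 1)"
  using assms base_le[of y] merged_bounds[of y \<tau>] by (auto simp: node_def intro!: code_less[simplified])

lemma node_end: "node y 0 = code (base y) 0" "node y (2 * N) = code (base y) (2 * N)"
  by (simp_all add: node_def)

lemma node_inner_neq_end:
  assumes "y < N" "0 < \<tau>" "\<tau> < 2 * N"
  shows "node y \<tau> \<noteq> node z 0" "node y \<tau> \<noteq> node z (2 * N)"
  using assms merged_bounds[of y \<tau>] by (auto simp: node_def code_eq_iff)

lemma node_start_neq_end: "node y 0 \<noteq> node z (2 * N)"
  using N_pos by (simp add: node_end code_eq_iff)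

lemma node_end_eqD:
  "node y 0 = node z 0 \<Longrightarrow> base y = base z" "node y (2 * N) = node z (2 * N) \<Longrightarrow> base y = base z"
  by (simp_all add: node_end code_eq_iff)

text \<open>A merged crossing with \<open>y\<close> as the row and \<open>u\<close> as the column.
  Giving \<open>\<rho>\<close> through a sum avoids truncated subtraction.\<close>

definition crosses :: "nat \<Rightarrow> nat \<Rightarrow> nat \<Rightarrow> nat \<Rightarrow> bool" where
  "crosses y \<tau> u \<rho> \<longleftrightarrow> u < base y \<and> (u, y) \<notin> E \<and> \<tau> = u + base y \<and> \<rho> + n = y + base y"

lemma crosses_bounds:
  assumes "crosses y \<tau> u \<rho>" "y < N"
  shows "\<tau> < 2 * base y" "2 * base u \<le> \<rho>" "0 < \<tau>" "\<tau> < 2 * N" "0 < \<rho>" "\<rho> < 2 * N" "u < N"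
  using assms less_base_add_le[of u y] base_le[of y] base_le[of u] base_add_le_N[of y] n_pos
  unfolding crosses_def by linarith+

lemma node_crosses:
  assumes "crosses y \<tau> u \<rho>" "y < N"
  shows "node y \<tau> = node u \<rho>"
proof -
  have "merged y \<tau>" "\<not> merged u \<rho>"
    using assms(1) crosses_bounds[OF assms] by (auto simp: merged_def crosses_def)
  moreover have "\<tau> - base y = u" "y + base y - n = \<rho>"
    using assms(1) by (auto simp: crosses_def)
  ultimately show ?thesis
    using crosses_bounds[OF assms] by (auto simp: node_def)
qed

text \<open>If both positions are merged, the strict growth of \<open>a + base a\<close> forces the
  same row; if exactly one is, comparing codes exhibits a crossing.\<close>

lemma node_eqD:
  assumes "node y \<tau> = node z \<rho>" "y < N" "z < N" "0 < \<tau>" "\<tau> < 2 * N" "0 < \<rho>" "\<rho> < 2 * N"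
  shows "(y = z \<and> \<tau> = \<rho>) \<or> crosses y \<tau> z \<rho> \<or> crosses z \<rho> y \<tau>"
proof -
  have merged: "n \<le> a + base a" "base a \<le> \<sigma>" if "merged a \<sigma>" for a \<sigma>
    using that le_base[of \<sigma> a] by (auto simp: merged_def)
  consider "merged y \<tau>" "merged z \<rho>" | "merged y \<tau>" "\<not> merged z \<rho>"
    | "\<not> merged y \<tau>" "merged z \<rho>" | "\<not> merged y \<tau>" "\<not> merged z \<rho>" by blast
  then show ?thesis
  proof cases
    case 1
    have eq: "\<tau> - base y = \<rho> - base z" "y + base y - n = z + base z - n"
      using code_eq_iff[of "y + base y - n" "z + base z - n" "\<tau> - base y" "\<rho> - base z"]
        assms 1 merged_bounds[of y \<tau>] merged_bounds[of z \<rho>] by (auto simp: node_def)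
    have "y = z"
    proof (rule ccontr)
      assume "y \<noteq> z"
      then consider "y < z" | "z < y" by linarith
      then show False
        using eq(2) merged[OF 1(1)] merged[OF 1(2)] base_mono[of y z] base_mono[of z y] by cases linarith+
    qed
    with eq merged[OF 1(1)] merged[OF 1(2)] show ?thesis by auto
  next
    case 2
    have eq: "\<tau> - base y = z" "y + base y - n = \<rho>"
      using code_eq_iff[of "y + base y - n" \<rho> "\<tau> - base y" z]
        assms 2 merged_bounds[of y \<tau>] by (auto simp: node_def)
    then have "crosses y \<tau> z \<rho>"
      using 2 merged[OF 2(1)] by (auto simp: crosses_def merged_def)
    then show ?thesis by blast
  next
    case 3
    have eq: "\<rho> - base z = y" "z + base z - n = \<tau>"
      using code_eq_iff[of \<tau> "z + base z - n" y "\<rho> - base z"]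
        assms 3 merged_bounds[of z \<rho>] by (auto simp: node_def)
    then have "crosses z \<rho> y \<tau>"
      using 3 merged[OF 3(2)] by (auto simp: crosses_def merged_def)
    then show ?thesis by blast
  next
    case 4
    then show ?thesis
      using code_eq_iff[of \<tau> \<rho> y z] assms by (auto simp: node_def)
  qed
qed

text \<open>
  The summand \<open>n\<close> compensates for the drop of \<open>\<tau> + y\<close> from row to column at a crossing. Each arc raises the level by one, except that the bend of a line costs \<open>n\<close> more.
\<close>

definition level :: "nat \<Rightarrow> nat \<Rightarrow> nat" where
  "level y \<tau> = (if 2 * base y \<le> \<tau> then \<tau> + y + n else \<tau> + y)"

text \<open>The lines of a block share their ends although their levels differ there, so the ends
  get fixed extreme values.\<close>

definition rank :: "nat \<Rightarrow> nat \<Rightarrow> nat" where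
  "rank y \<tau> = (if \<tau> = 0 then 0 else if \<tau> = 2 * N then 4 * N else level y \<tau>)"

text \<open>Both sides equal \<open>u + y + base y\<close>.\<close>

lemma level_crosses: "crosses y \<tau> u \<rho> \<Longrightarrow> y < N \<Longrightarrow> level y \<tau> = level u \<rho>"
  using crosses_bounds[of y \<tau> u \<rho>] by (auto simp: level_def crosses_def)

lemma rank_less:
  assumes "y < N" "\<tau> < 2 * N"
  shows "rank y \<tau> < rank y (Suc \<tau>)"
proof -
  have "n \<le> N" using base_add_le_N[OF assms(1)] by linarith
  with assms show ?thesis by (auto simp: rank_def level_def)
qed

definition node_rank :: "nat \<Rightarrow> nat" where
  "node_rank c = (let y = c div (2 * N + 1); \<tau> = c mod (2 * N + 1) in rank y \<tau>)"

text \<open>Decoding returns the column of a merged crossing, where \<open>level_crosses\<close>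
  applies, and the first line of a block for an end, where \<open>rank\<close> ignores the
  line.\<close>

lemma node_rank_node:
  assumes "y < N" "\<tau> \<le> 2 * N"
  shows "node_rank (node y \<tau>) = rank y \<tau>"
proof -
  have code: "node_rank (code a b) = rank a b" if "b \<le> 2 * N" for a b
    unfolding node_rank_def code_div_mod[OF that] Let_def ..
  consider "\<tau> = 0" | "\<tau> = 2 * N" | "0 < \<tau>" "\<tau> < 2 * N" "merged y \<tau>"
    | "0 < \<tau>" "\<tau> < 2 * N" "\<not> merged y \<tau>" using assms(2) by linarith
  then show ?thesis
  proof cases
    case 1
    then show ?thesis using code[of 0 "base y"] by (simp add: node_def rank_def)
  next
    case 2
    then show ?thesis using code[of "2 * N" "base y"] N_pos by (simp add: node_def rank_def)
  next
    case 3
    then have c: "crosses y \<tau> (\<tau> - base y) (y + base y - n)"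
      using le_base[of \<tau> y] by (auto simp: merged_def crosses_def)
    note crosses_bounds[OF c assms(1)]
    with 3 code[of "y + base y - n" "\<tau> - base y"] level_crosses[OF c assms(1)]
    show ?thesis by (auto simp: node_def rank_def)
  next
    case 4
    then show ?thesis using code[of \<tau> y] by (simp add: node_def)
  qed
qed

text \<open>Strict growth of \<open>rank\<close> along a line separates its vertices.\<close>

lemma node_inj:
  assumes "y < N" "\<tau> \<le> 2 * N" "\<rho> \<le> 2 * N" "node y \<tau> = node y \<rho>"
  shows "\<tau> = \<rho>"
proof -
  have "rank y \<sigma> < rank y \<sigma>'" if "\<sigma> < \<sigma>'" "\<sigma>' \<le> 2 * N" for \<sigma> \<sigma>'
    using that
  proof (induction \<sigma>')
    case (Suc m)
    with rank_less[OF assms(1), of m] show ?case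
      by (cases "\<sigma> = m") auto
  qed simp
  moreover have "rank y \<tau> = rank y \<rho>"
    using assms node_rank_node by metis
  ultimately show ?thesis
    using assms(2,3) by (metis less_irrefl linorder_neqE_nat)
qed

section \<open>Acyclicity, with the rank as potential\<close>

lemma parcs_grid: "parcs grid = {(node y \<tau>, node y (Suc \<tau>)) | y \<tau>. y < N \<and> \<tau> < 2 * N}"
  and pverts_grid: "pverts grid = {..<N * (2 * N + 1)}"
  by (simp_all add: grid_def)

lemma node_rank_less: "(a, b) \<in> parcs grid \<Longrightarrow> node_rank a < node_rank b"
  by (auto simp: parcs_grid node_rank_node rank_less)

lemma dag_grid: "dag grid"
proof -
  have fin: "finite (parcs grid)"
  proof (rule finite_subset)
    show "parcs grid \<subseteq> {..<N * (2 * N + 1)} \<times> {..<N * (2 * N + 1)}"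
      using node_less by (auto simp: parcs_grid)
  qed simp
  have "pair_digraph grid"
  proof
    show "fst e \<in> pverts grid" if "e \<in> parcs grid" for e
      using that node_less by (auto simp: parcs_grid pverts_grid)
    show "snd e \<in> pverts grid" if "e \<in> parcs grid" for e
      using that node_less by (auto simp: parcs_grid pverts_grid)
    show "fst e \<noteq> snd e" if "e \<in> parcs grid" for e
      using that node_rank_less[of "fst e" "snd e"] by auto
  qed (simp_all add: fin pverts_grid)
  moreover have "acyclic (parcs grid)"
  proof (rule wf_acyclic[OF wf_subset[OF wf_measure[of node_rank]]])
    show "parcs grid \<subseteq> measure node_rank" using node_rank_less by auto
  qed
  ultimately show ?thesis by (simp add: dag_def)
qed


section \<open>Walks in the line arrangement\<close>

sublocale wf_digraph "with_proj grid"
  using dag_grid by (simp add: dag_def wf_digraph_wp_iff pair_digraph_def pair_fin_digraph_def)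

lemma line_0: "line y 0 = []"
  and line_Suc: "line y (Suc m) = line y m @ [(node y m, node y (Suc m))]"
  by (simp_all add: line_def)

lemma length_line: "length (line y m) = m"
  by (simp add: line_def)

lemma awalk_verts_line: "awalk_verts (node y 0) (line y m) = map (node y) [0..<Suc m]"
  by (cases m) (simp_all add: awalk_verts_conv line_def)

lemma awalk_line:
  assumes "y < N" "m \<le> 2 * N"
  shows "awalk (node y 0) (line y m) (node y m)"
  using assms(2)
proof (induction m)
  case 0
  then show ?case
    using assms node_less by (simp add: line_0 awalk_Nil_iff pverts_grid)
next
  case (Suc m)
  have "(node y m, node y (Suc m)) \<in> parcs grid"
    unfolding parcs_grid using Suc.prems assms(1) Suc_le_eq by blast
  moreover have "node y (Suc m) \<in> pverts grid"
    using node_less[OF assms(1) Suc.prems] by (simp add: pverts_grid)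
  moreover have "awalk (node y 0) (line y m) (node y m)"
    using Suc by simp
  ultimately show ?case
    by (auto simp: line_Suc awalk_Cons_iff awalk_Nil_iff elim!: awalk_appendI)
qed

lemma apath_line:
  assumes "y < N"
  shows "apath (node y 0) (line y (2 * N)) (node y (2 * N))"
proof -
  have "inj_on (node y) {0..<Suc (2 * N)}"
    using node_inj[OF assms] by (auto intro!: inj_onI)
  then show ?thesis
    unfolding apath_def awalk_verts_line using awalk_line[OF assms] by (simp add: distinct_map del: upt_Suc)
qed

lemma awalk_cost_one: "awalk_cost (\<lambda>_. 1) p = length p"
  by (simp add: awalk_cost_def sum_list_triv)

text \<open>The horizontal coordinate. A row passes column \<open>u\<close> at time
  \<open>u + base y\<close>, so its stretch before column 0 is negative; hence integers.\<close>

definition abscissa :: "nat \<Rightarrow> nat \<Rightarrow> int" where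
  "abscissa y \<tau> = (if 2 * base y \<le> \<tau> then int y else int \<tau> - int (base y))"

text \<open>
  \<open>bent v l y \<tau>\<close> is an invariant of walks of length \<open>l\<close> that start on line \<open>v\<close> and have left it, at
  time \<open>\<tau>\<close> of line \<open>y\<close>. Up to column \<open>v\<close> such a walk cannot have used the bend of any
  line, so its length is the full gain in level; up to the end of the block of \<open>v\<close> it has used at
  most one bend. Further to the right nothing is needed, since abscissas never decrease.
\<close>

definition bent :: "nat \<Rightarrow> nat \<Rightarrow> nat \<Rightarrow> nat \<Rightarrow> bool" where
  "bent v l y \<tau> \<longleftrightarrow>
     (if 2 * base y \<le> \<tau> then v + base v < \<tau> + n else v < y) \<and>
     (abscissa y \<tau> < int (base v + n) \<longrightarrow>
        level y \<tau> \<le> l + v + (if abscissa y \<tau> \<le> int v then 0 else n))"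

text \<open>A merged vertex has a position on each line, and the invariant must not depend on the
  choice. Abscissa and level agree, and the side conditions match since \<open>a + base a\<close> is
  strictly increasing.\<close>

lemma bent_crosses:
  assumes "crosses y \<tau> u \<rho>" "y < N"
  shows "bent v l y \<tau> \<longleftrightarrow> bent v l u \<rho>"
proof -
  have "v + base v < y + base y \<longleftrightarrow> v < y"
    using base_mono[of v y] base_mono[of y v] by linarith
  moreover have "abscissa y \<tau> = int u" "abscissa u \<rho> = int u"
    using assms(1) crosses_bounds[OF assms] by (auto simp: abscissa_def crosses_def)
  ultimately show ?thesis
    using assms(1) crosses_bounds[OF assms] level_crosses[OF assms]
    by (auto simp: bent_def crosses_def)
qed

text \<open>Only the bend is critical. In the block of \<open>v\<close> it raises the level by
  \<open>n + 1\<close>, but \<open>v < y\<close> moves the abscissa past \<open>v\<close>, which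
  grants the allowance \<open>n\<close>; in a later block the abscissa bound fails.\<close>

lemma bent_Suc:
  assumes "bent v l y \<tau>"
  shows "bent v (Suc l) y (Suc \<tau>)"
proof -
  consider "2 * base y \<le> \<tau>" | "Suc \<tau> < 2 * base y" | "Suc \<tau> = 2 * base y" by linarith
  then show ?thesis
  proof cases
    case 3
    have "base v + n \<le> base y \<or> base y = base v" "base v \<le> base y"
      using 3 assms base_mono[of v y] base_add_le_base[of v y]
      by (auto simp: bent_def not_le less_Suc_eq_le)
    then show ?thesis
      using 3 assms base_le[of y] less_base_add[of v] less_base_add[of y] base_le[of v] n_pos
      by (auto simp: bent_def abscissa_def level_def)
  qed (use assms n_pos in \<open>auto simp: bent_def abscissa_def level_def split: if_splits\<close>)
qed

text \<open>No bend has been used and \<open>u < base v\<close>, so the level bound holds with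
  equality and no allowance.\<close>

lemma bent_leave_row:
  assumes "crosses v \<tau> u \<rho>" "v < N"
  shows "bent v (Suc \<tau>) u (Suc \<rho>)"
  using assms(1) crosses_bounds[OF assms] base_le[of v]
  by (auto simp: bent_def abscissa_def level_def crosses_def)

text \<open>The walk has used the bend of \<open>v\<close>; the step moves the abscissa past
  \<open>v\<close>, so the allowance \<open>n\<close> pays for it.\<close>

lemma bent_leave_column:
  assumes "crosses y \<tau> v \<rho>" "y < N"
  shows "bent v (Suc \<rho>) y (Suc \<tau>)"
  using assms(1) crosses_bounds[OF assms] base_le[of v] base_le[of y] less_base_add_le[of v y]
  by (auto simp: bent_def abscissa_def level_def crosses_def)

text \<open>Induction on the last arc. The line \<open>v\<close> is determined by the first arc,
  since the lines of a block leave the same source.\<close>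

lemma walk_straight_or_bent:
  assumes "awalk (node (i * n) 0) p a" "p \<noteq> []" "i < k"
  shows "\<exists>v y \<tau>. v < N \<and> base v = i * n \<and> y < N \<and> 0 < \<tau> \<and> \<tau> \<le> 2 * N \<and> a = node y \<tau> \<and>
    (y = v \<and> p = line v \<tau> \<or> bent v (length p) y \<tau>)"
  using assms(1,2)
proof (induction p arbitrary: a rule: rev_induct)
  case (snoc e p)
  let ?s = "node (i * n) 0"
  have e: "e \<in> parcs grid" "a = snd e" "awalk ?s p (fst e)"
    using snoc.prems(1) by (auto simp: awalk_Cons_iff awalk_Nil_iff)
  then obtain z \<rho> where z: "e = (node z \<rho>, node z (Suc \<rho>))" "z < N" "\<rho> < 2 * N"
    by (auto simp: parcs_grid)
  show ?case
  proof (cases "p = []")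
    case True
    then have "node z \<rho> = ?s"
      using e(3) z(1) by (simp add: awalk_Nil_iff)
    then have "\<rho> = 0" "base z = i * n"
      using node_inner_neq_end(1)[of z \<rho> "i * n"] z(2,3) node_end_eqD(1)[of z "i * n"] n_pos
      by (auto simp: base_def)
    then show ?thesis
      using True e(2) z by (intro exI[of _ z] exI[of _ 1]) (auto simp: line_def)
  next
    case False
    from snoc.IH[OF e(3) this] obtain v y \<tau> where IH: "v < N" "base v = i * n" "y < N" "0 < \<tau>"
      "\<tau> \<le> 2 * N" "fst e = node y \<tau>" "y = v \<and> p = line v \<tau> \<or> bent v (length p) y \<tau>" by blast
    have eq: "node z \<rho> = node y \<tau>"
      using IH(6) z(1) by simp
    have "0 < \<rho>"
      using eq IH(3-5) node_inner_neq_end(1)[of y \<tau> z] node_start_neq_end[of z y]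
      by (cases "\<tau> = 2 * N") (auto intro: gr0I)
    have "\<tau> < 2 * N"
      using eq z(2,3) \<open>0 < \<rho>\<close> node_inner_neq_end(2)[of z \<rho> y] IH(5) by (cases "\<tau> = 2 * N") auto
    \<comment> \<open>The arc places its tail on \<open>z\<close>, the hypothesis places it on
      \<open>y\<close>. By \<open>node_eqD\<close> the walk stays on its line, turns from a column
      into a row, or turns from a row into a column.\<close>
    have "z = v \<and> p @ [e] = line v (Suc \<rho>) \<or> bent v (length (p @ [e])) z (Suc \<rho>)"
      using node_eqD[OF eq z(2) IH(3) \<open>0 < \<rho>\<close> z(3) IH(4) \<open>\<tau> < 2 * N\<close>]
    proof (elim disjE)
      assume "z = y \<and> \<rho> = \<tau>"
      then show ?thesis using IH(7) z(1) by (auto simp: line_Suc bent_Suc)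
    next
      assume "crosses z \<rho> y \<tau>"
      then show ?thesis
        using IH(7) bent_crosses[of z \<rho> y \<tau>] z(2) bent_leave_column[of z \<rho> v \<tau>]
        by (auto simp: length_line intro: bent_Suc)
    next
      assume "crosses y \<tau> z \<rho>"
      then show ?thesis
        using IH(3,7) bent_crosses[of y \<tau> z \<rho>] bent_leave_row[of v \<tau> z \<rho>]
        by (auto simp: length_line intro: bent_Suc)
    qed
    then show ?thesis
      using IH(1,2) z e(2) by (intro exI[of _ v] exI[of _ z] exI[of _ "Suc \<rho>"]) auto
  qed
qed simp

section \<open>Shortest paths between the terminals of a part\<close>

lemma base_mult: "base (i * n) = i * n"
  using n_pos by (simp add: base_def)

lemma node_block: 
  assumes "v div n = i"
  shows "node v 0 = node (i * n) 0" "node v (2 * N) = node (i * n) (2 * N)"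
  using assms unfolding node_end base_mult by (simp_all add: base_def)

text \<open>At the target \<open>y\<close> and \<open>v\<close> share a block. A bent walk then
  exceeds \<open>2 * N\<close> by at least \<open>n - (v - y)\<close> if \<open>y \<le> v\<close>,
  and by at least \<open>y - v\<close> otherwise; both are positive.\<close>

lemma walk_length:
  assumes "awalk (node (i * n) 0) p (node (i * n) (2 * N))" "i < k"
  shows "2 * N \<le> length p"
    and "length p = 2 * N \<Longrightarrow> \<exists>v<N. v div n = i \<and> p = line v (2 * N)"
proof -
  have "p \<noteq> []"
    using assms(1) node_start_neq_end by (auto simp: awalk_Nil_iff)
  with walk_straight_or_bent[OF assms(1) _ assms(2)] obtain v y \<tau> where v: "v < N" "base v = i * n"
    and y: "y < N" "0 < \<tau>" "\<tau> \<le> 2 * N" "node (i * n) (2 * N) = node y \<tau>"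
    and p: "y = v \<and> p = line v \<tau> \<or> bent v (length p) y \<tau>" by blast
  have "\<tau> = 2 * N"
    using y node_inner_neq_end(2)[of y \<tau> "i * n"] by (cases "\<tau> < 2 * N") auto
  then have "base y = base v"
    using node_end_eqD(2)[of "i * n" y] y(4) v(2) by (simp add: base_mult)
  have "y = v \<and> p = line v (2 * N) \<or> 2 * N < length p"
    using p
  proof (rule disj_forward)
    assume "bent v (length p) y \<tau>"
    then show "2 * N < length p"
      using \<open>\<tau> = 2 * N\<close> \<open>base y = base v\<close> less_base_add[of y] less_base_add[of v] base_le[of v]
        base_le[of y] y(1)
      by (auto simp: bent_def abscissa_def level_def split: if_splits)
  qed (use \<open>\<tau> = 2 * N\<close> in simp)
  moreover have "v div n = i"
    using v(2) n_pos by (simp add: base_def)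
  ultimately show "2 * N \<le> length p"
    and "length p = 2 * N \<Longrightarrow> \<exists>v<N. v div n = i \<and> p = line v (2 * N)"
    using v(1) by (auto simp: length_line)
qed

text \<open>The lines attain the lower bound of \<open>walk_length\<close>, and no other walk
  does.\<close>

lemma shortest_apath_iff:
  assumes "i < k"
  shows "shortest_apath (\<lambda>_. 1) (node (i * n) 0) p (node (i * n) (2 * N)) \<longleftrightarrow>
    (\<exists>v<N. v div n = i \<and> p = line v (2 * N))"
proof -
  let ?s = "node (i * n) 0" and ?t = "node (i * n) (2 * N)"
  have line: "apath ?s (line v (2 * N)) ?t" if "v < N" "v div n = i" for v
    using apath_line[OF that(1)] node_block[OF that(2)] by simp
  have "i * n < N"
    using assms n_pos by (simp add: N_def)
  then have "awalk ?s (line (i * n) (2 * N)) ?t"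
    using awalk_line by simp
  then have "\<mu> (\<lambda>_. 1) ?s ?t \<le> 2 * N"
    using min_cost_le_walk_cost[of ?s "line (i * n) (2 * N)" ?t "\<lambda>_. 1"]
    by (simp add: awalk_cost_one length_line)
  moreover have "2 * N \<le> \<mu> (\<lambda>_. 1) ?s ?t"
    unfolding \<mu>_def
    using of_nat_mono[OF walk_length(1)[OF _ assms], where 'a = real]
    by (intro INF_greatest) (simp add: awalk_cost_one)
  ultimately have "\<mu> (\<lambda>_. 1) ?s ?t = 2 * N"
    by (rule antisym)
  moreover have "real (length p) = 2 * real N \<longleftrightarrow> length p = 2 * N"
    by linarith
  ultimately have "shortest_apath (\<lambda>_. 1) ?s p ?t \<longleftrightarrow> apath ?s p ?t \<and> length p = 2 * N"
    by (simp add: shortest_apath_def awalk_cost_one)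
  also have "\<dots> \<longleftrightarrow> (\<exists>v<N. v div n = i \<and> p = line v (2 * N))"
    using line walk_length(2)[OF _ assms] by (auto simp: length_line apath_def)
  finally show ?thesis .
qed

section \<open>Disjointness of lines and transversal cliques\<close>

lemma inner_verts_line: "set (inner_verts (line y (2 * N))) = node y ` {0<..<2 * N}"
proof -
  have "inner_verts (line y (2 * N)) = map (node y) (tl [0..<2 * N])"
    by (simp add: inner_verts_def line_def comp_def flip: map_tl)
  also have "tl [0..<2 * N] = [1..<2 * N]"
    by (simp add: tl_upt)
  finally show ?thesis by auto
qed

text \<open>Lines from different parts cross once, the one with the larger base being the row; an
  inner vertex is never an end of a line.\<close>

lemma lines_disjoint_iff:
  assumes "y < N" "z < N" "y div n \<noteq> z div n" "sym E"
  shows "node y ` {0<..<2 * N} \<inter> node z ` {0..2 * N} = {} \<longleftrightarrow> (y, z) \<in> E"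
proof
  assume disjoint: "node y ` {0<..<2 * N} \<inter> node z ` {0..2 * N} = {}"
  show "(y, z) \<in> E"
  proof (rule ccontr)
    assume "(y, z) \<notin> E"
    then have "(z, y) \<notin> E" using assms(4) by (auto dest: symD)
    have base: "base y \<noteq> base z"
      using assms(3) n_pos by (simp add: base_def)
    obtain \<tau> \<rho> where "crosses y \<tau> z \<rho> \<or> crosses z \<rho> y \<tau>"
    proof (cases "base y < base z")
      case True
      then show ?thesis
        using \<open>(y, z) \<notin> E\<close> base_add_le_base[of y z] less_base_add[of y]
        by (intro that[of "z + base z - n" "y + base z"]) (auto simp: crosses_def)
    next
      case False
      then show ?thesis
        using \<open>(z, y) \<notin> E\<close> base base_add_le_base[of z y] less_base_add[of z]
        by (intro that[of "z + base y" "y + base y - n"]) (auto simp: crosses_def)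
    qed
    then have "node y \<tau> = node z \<rho>" "0 < \<tau>" "\<tau> < 2 * N" "\<rho> < 2 * N"
      using node_crosses[of y \<tau> z \<rho>] node_crosses[of z \<rho> y \<tau>] crosses_bounds[of y \<tau> z \<rho>]
        crosses_bounds[of z \<rho> y \<tau>] assms(1,2) by auto
    moreover from this have "node y \<tau> \<in> node y ` {0<..<2 * N}" "node z \<rho> \<in> node z ` {0..2 * N}"
      by (intro imageI; simp)+
    ultimately show False
      using disjoint by (metis IntI empty_iff)
  qed
next
  assume yz: "(y, z) \<in> E"
  have False if "0 < \<tau>" "\<tau> < 2 * N" "\<rho> \<le> 2 * N" "node y \<tau> = node z \<rho>" for \<tau> \<rho>
  proof -
    have "\<rho> \<noteq> 0" "\<rho> \<noteq> 2 * N"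
      using that node_inner_neq_end[OF assms(1) that(1,2), of z] by metis+
    then show False
      using node_eqD[OF that(4) assms(1,2)] that yz assms(3,4) by (auto simp: crosses_def dest: symD)
  qed
  then show "node y ` {0<..<2 * N} \<inter> node z ` {0..2 * N} = {}" by auto
qed

lemma disjoint_shortest_paths_iff:
  assumes "sym E"
  shows "disjoint_shortest_paths (\<lambda>_. 1) k (\<lambda>i. node (i * n) 0) (\<lambda>i. node (i * n) (2 * N)) \<longleftrightarrow>
    (\<exists>v. (\<forall>i<k. v i < N \<and> v i div n = i) \<and> (\<forall>i<k. \<forall>j<k. i \<noteq> j \<longrightarrow> (v i, v j) \<in> E))"
    (is "?L \<longleftrightarrow> ?R")
proof -
  have disjoint: "set (inner_verts (line (v i) (2 * N))) \<inter>
      set (awalk_verts (node (j * n) 0) (line (v j) (2 * N))) = {} \<longleftrightarrow> (v i, v j) \<in> E"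
    if "\<forall>i<k. v i < N \<and> v i div n = i" "i < k" "j < k" "i \<noteq> j" for v i j
  proof -
    have "set (awalk_verts (node (j * n) 0) (line (v j) (2 * N))) = node (v j) ` {0..2 * N}"
      using that(1,3) node_block(1)[of "v j" j] awalk_verts_line[of "v j" "2 * N"]
      by (auto simp: less_Suc_eq_le atLeastLessThanSuc_atLeastAtMost simp del: upt_Suc)
    then show ?thesis
      using lines_disjoint_iff[OF _ _ _ assms, of "v i" "v j"] that by (simp add: inner_verts_line)
  qed
  show ?thesis
  proof
    assume ?L
    then obtain P where P: "\<forall>i<k. \<exists>v<N. v div n = i \<and> P i = line v (2 * N)"
      "\<forall>i<k. \<forall>j<k. i \<noteq> j \<longrightarrow> set (inner_verts (P i)) \<inter> set (awalk_verts (node (j * n) 0) (P j)) = {}"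
      unfolding disjoint_shortest_paths_def by (auto simp: shortest_apath_iff)
    from P(1) obtain v where "\<forall>i<k. v i < N \<and> v i div n = i" "\<forall>i<k. P i = line (v i) (2 * N)"
      by metis
    with P(2) disjoint[of v] show ?R by (intro exI[of _ v]) simp
  next
    assume ?R
    then obtain v where v: "\<forall>i<k. v i < N \<and> v i div n = i" "\<forall>i<k. \<forall>j<k. i \<noteq> j \<longrightarrow> (v i, v j) \<in> E"
      by blast
    with disjoint[OF v(1)] show ?L
      unfolding disjoint_shortest_paths_def
      by (intro exI[of _ "\<lambda>i. line (v i) (2 * N)"]) (auto simp: shortest_apath_iff)
  qed
qed

end

text \<open>Adjacent vertices lie in different parts, so the \<open>k\<close> vertices of a clique
  meet each of the \<open>k\<close> parts exactly once.\<close>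

lemma has_clique_iff_transversal:
  assumes "kpartite_graph k n G" "1 \<le> n"
  shows "has_clique G k \<longleftrightarrow>
    (\<exists>v. (\<forall>i<k. v i < k * n \<and> v i div n = i) \<and> (\<forall>i<k. \<forall>j<k. i \<noteq> j \<longrightarrow> (v i, v j) \<in> parcs G))"
    (is "?L \<longleftrightarrow> ?R")
proof
  assume ?L
  then obtain X where X: "X \<subseteq> {..<k * n}" "finite X" "card X = k"
    "\<forall>u\<in>X. \<forall>v\<in>X. u \<noteq> v \<longrightarrow> (u, v) \<in> parcs G"
    using assms(1) by (auto simp: has_clique_def kpartite_graph_def)
  have "inj_on (\<lambda>u. u div n) X"
    using X(4) assms(1) by (fastforce simp: kpartite_graph_def intro: inj_onI)
  then have "card ((\<lambda>u. u div n) ` X) = k"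
    using X(3) by (simp add: card_image)
  moreover have "(\<lambda>u. u div n) ` X \<subseteq> {..<k}"
    using X(1) by (auto simp: less_mult_imp_div_less)
  ultimately have "(\<lambda>u. u div n) ` X = {..<k}"
    by (intro card_subset_eq) auto
  then have "\<forall>i<k. \<exists>u\<in>X. u div n = i" by (metis (no_types, lifting) imageE lessThan_iff)
  then obtain v where v: "\<forall>i<k. v i \<in> X \<and> v i div n = i" by metis
  with X(1,4) show ?R by (intro exI[of _ v]) (auto, metis)
next
  assume ?R
  then obtain v where v: "\<forall>i<k. v i < k * n \<and> v i div n = i"
    "\<forall>i<k. \<forall>j<k. i \<noteq> j \<longrightarrow> (v i, v j) \<in> parcs G" by blast
  have "inj_on v {..<k}"
    using v(1) by (metis inj_onI lessThan_iff)
  then have "card (v ` {..<k}) = k" by (simp add: card_image)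
  with v show ?L
    using assms(1) unfolding has_clique_def kpartite_graph_def
    by (intro exI[of _ "v ` {..<k}"]) auto
qed


section \<open>Programs with a polynomial word bound\<close>

text \<open>The exponent in the value bound of \<open>aval_le_power\<close>: operations multiply
  bounds, so exponents add.\<close>

fun size_exp :: "aexp \<Rightarrow> nat" where
  "size_exp (Const c) = 1"
| "size_exp (Get a e) = size_exp e + 1"
| "size_exp (Bop b e1 e2) = size_exp e1 + size_exp e2"

text \<open>Bounding whole arrays makes the bound independent of the index that is read.\<close>

fun bounded_exp :: "nat \<Rightarrow> store \<Rightarrow> aexp \<Rightarrow> bool" where
  "bounded_exp Q S (Const c) \<longleftrightarrow> c \<le> Q"
| "bounded_exp Q S (Get a e) \<longleftrightarrow> (\<forall>x. S a x \<le> Q) \<and> bounded_exp Q S e"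
| "bounded_exp Q S (Bop b e1 e2) \<longleftrightarrow> bounded_exp Q S e1 \<and> bounded_exp Q S e2"

lemma size_exp_pos: "0 < size_exp e"
  by (induction e) auto

text \<open>Bounds of at least 2 make the product dominate the sum, so one bound covers every
  operation.\<close>

lemma bop_val_le:
  fixes x y X Y :: nat
  assumes "x \<le> X" "y \<le> Y" "2 \<le> X" "2 \<le> Y"
  shows "bop_val b x y \<le> X * Y"
proof -
  have "X + Y \<le> X * Y"
  proof -
    obtain X' Y' where "X = X' + 2" "Y = Y' + 2"
      using assms(3,4) by (metis add.commute le_Suc_ex)
    then show ?thesis by (simp add: algebra_simps)
  qed
  moreover have "x * y \<le> X * Y"
    using assms by (intro mult_le_mono)
  moreover have "x div y \<le> x" "x mod y \<le> x"
    by simp_all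
  ultimately show ?thesis
    using assms by (cases b) (simp_all del: mod_less_eq_dividend div_le_dividend)
qed

lemma aval_le_power:
  assumes "bounded_exp Q S e" "2 \<le> Q"
  shows "aval e S \<le> Q ^ size_exp e"
  using assms(1)
proof (induction e)
  case (Get a e)
  have "Q ^ 1 \<le> Q ^ (size_exp e + 1)"
    using assms(2) by (intro power_increasing) auto
  with Get.prems show ?case by (auto intro: order_trans)
next
  case (Bop b e1 e2)
  have "2 \<le> Q ^ size_exp e" for e
    using power_increasing[of 1 "size_exp e" Q] assms(2) size_exp_pos[of e] by simp
  with Bop show ?case by (simp add: power_add bop_val_le)
qed simp

lemma fits_if_bounded:
  assumes "bounded_exp Q S e" "2 \<le> Q" "Q ^ size_exp e < 2 ^ w"
  shows "fits w e S"
  using assms(1,3)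
proof (induction e)
  case (Const c)
  then show ?case by simp
next
  case (Get a e)
  have mono: "Q ^ size_exp e \<le> Q ^ size_exp (Get a e)" "Q ^ 1 \<le> Q ^ size_exp (Get a e)"
    using assms(2) by (intro power_increasing; simp)+
  have "fits w e S"
    using Get.IH Get.prems mono(1) by (meson bounded_exp.simps(2) le_less_trans)
  moreover have "S a (aval e S) \<le> Q"
    using Get.prems(1) by simp
  then have "S a (aval e S) < 2 ^ w"
    using mono(2)[unfolded power_one_right] Get.prems(2) by linarith
  ultimately show ?case by simp
next
  case (Bop b e1 e2)
  have "Q ^ size_exp e1 \<le> Q ^ size_exp (Bop b e1 e2)" "Q ^ size_exp e2 \<le> Q ^ size_exp (Bop b e1 e2)"
    using assms(2) by (intro power_increasing; simp)+
  then have "fits w e1 S" "fits w e2 S"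
    using Bop by (meson bounded_exp.simps(3) le_less_trans)+
  moreover have "aval (Bop b e1 e2) S < 2 ^ w"
    using aval_le_power[OF Bop.prems(1) assms(2)] Bop.prems(2) by linarith
  ultimately show ?case by simp
qed

text \<open>The invariant carries the iteration number; a body of constant time gives an exact
  running time.\<close>

lemma exec_While_count:
  assumes guard: "\<And>j S. I j S \<Longrightarrow> j \<le> m \<Longrightarrow> fits w e S \<and> (aval e S = 0 \<longleftrightarrow> j = m)"
    and body: "\<And>j S. I j S \<Longrightarrow> j < m \<Longrightarrow> \<exists>S'. exec w c S T S' \<and> I (Suc j) S'"
    and "I 0 S"
  shows "\<exists>S'. exec w (While e c) S (m * (acost e + 1 + T) + (acost e + 1)) S' \<and> I m S'"
proof -
  have "\<exists>S'. exec w (While e c) S ((m - j) * (acost e + 1 + T) + (acost e + 1)) S' \<and> I m S'"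
    if "j \<le> m" "I j S" for j S
    using that
  proof (induction arbitrary: S rule: inc_induct)
    case base
    then show ?case using guard[of m S] exec.WhileFalse[of w e S c] by auto
  next
    case (step j)
    obtain S1 where S1: "exec w c S T S1" "I (Suc j) S1"
      using body[OF step.prems step.hyps(2)] by blast
    obtain S2 where S2: "exec w (While e c) S1 ((m - Suc j) * (acost e + 1 + T) + (acost e + 1)) S2" "I m S2"
      using step.IH[OF S1(2)] by blast
    have "m - j = Suc (m - Suc j)"
      using step.hyps(2) by simp
    then have time: "(m - j) * (acost e + 1 + T) + (acost e + 1) =
        acost e + 1 + T + ((m - Suc j) * (acost e + 1 + T) + (acost e + 1))"
      by simp
    have "exec w (While e c) S ((m - j) * (acost e + 1 + T) + (acost e + 1)) S2"
      unfolding time using guard[OF step.prems] step.hyps(2) S1(1) S2(1)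
      by (intro exec.WhileTrue) simp_all
    with S2(2) show ?case by blast
  qed
  from this[of 0] assms(3) show ?thesis by simp
qed

section \<open>Computing the line arrangement\<close>

definition k_exp :: aexp where "k_exp = Get 0 (Const 0)"
definition n_exp :: aexp where "n_exp = Get 1 (Const 0)"
definition j_exp :: aexp where "j_exp = Get 9 (Const 0)"
definition N_exp :: aexp where "N_exp = Bop Mul k_exp n_exp"
definition L_exp :: aexp where "L_exp = Bop Mul (Const 2) N_exp"
text \<open>The counter enumerates arcs line by line, \<open>2 * N\<close> per line: the quotient is
  the line, the remainder the position.\<close>

definition y_exp :: aexp where "y_exp = Bop Div j_exp L_exp"
definition block_exp :: aexp where "block_exp = Bop Div y_exp n_exp"
definition base_exp :: aexp where "base_exp = Bop Mul block_exp n_exp"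
definition arcs_exp :: aexp where "arcs_exp = Bop Mul N_exp L_exp"

definition code_exp :: "aexp \<Rightarrow> aexp \<Rightarrow> aexp" where
  "code_exp a b = Bop Add (Bop Mul a (Bop Add L_exp (Const 1))) b"

text \<open>Truncated subtraction from 1 negates, which makes the loop body branch-free.\<close>

definition choose_exp :: "aexp \<Rightarrow> aexp \<Rightarrow> aexp \<Rightarrow> aexp" where
  "choose_exp e e1 e2 =
     Bop Add (Bop Mul (Bop Sub (Const 1) (Bop Sub (Const 1) e)) e1) (Bop Mul (Bop Sub (Const 1) e) e2)"

text \<open>The factors are truncated differences, so the product is nonzero iff all three tests hold.\<close>

definition merged_exp :: "aexp \<Rightarrow> aexp" where
  "merged_exp t = Bop Mul (Bop Mul (Bop Sub (Bop Add t (Const 1)) base_exp)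
     (Bop Sub (Bop Mul (Const 2) base_exp) t))
     (Bop Sub (Const 1) (Get 2 (Bop Add (Bop Mul (Bop Sub t base_exp) N_exp) y_exp)))"

text \<open>For \<open>t\<close> up to \<open>2 * N\<close> the first test vanishes exactly at the
  two ends.\<close>

definition node_exp :: "aexp \<Rightarrow> aexp" where
  "node_exp t = choose_exp (Bop Mul t (Bop Sub L_exp t))
     (choose_exp (merged_exp t)
        (code_exp (Bop Sub t base_exp) (Bop Sub (Bop Add y_exp base_exp) n_exp))
        (code_exp y_exp t))
     (code_exp base_exp t)"

definition t_exp :: aexp where "t_exp = Bop Mod j_exp L_exp"
definition tail_exp :: aexp where "tail_exp = node_exp t_exp"
definition head_exp :: aexp where "head_exp = node_exp (Bop Add t_exp (Const 1))"
definition source_exp :: aexp where "source_exp = code_exp base_exp (Const 0)"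
definition target_exp :: aexp where "target_exp = code_exp base_exp L_exp"
definition next_exp :: aexp where "next_exp = Bop Add j_exp (Const 1)"
definition verts_exp :: aexp where "verts_exp = code_exp N_exp (Const 0)"
definition guard_exp :: aexp where "guard_exp = Bop Sub arcs_exp j_exp"

lemma aval_choose_exp: "aval (choose_exp e e1 e2) S = (if aval e S = 0 then aval e2 S else aval e1 S)"
  by (simp add: choose_exp_def)

text \<open>The terminals of a block are rewritten with the same values for each of its arcs, which
  saves a second loop.\<close>

definition loop_body :: com where
  "loop_body = Seq (Put 5 j_exp tail_exp) (Seq (Put 6 j_exp head_exp) (Seq (Put 7 block_exp source_exp)
     (Seq (Put 8 block_exp target_exp) (Put 9 (Const 0) next_exp))))"

definition reduction_prog :: com where
  "reduction_prog = Seq (Put 3 (Const 0) verts_exp) (Seq (Put 4 (Const 0) arcs_exp)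
     (While guard_exp loop_body))"

definition exps :: "aexp list" where
  "exps = [Const 0, j_exp, tail_exp, head_exp, block_exp, source_exp, target_exp, next_exp, verts_exp,
     arcs_exp, guard_exp]"

lemmas exp_defs = k_exp_def n_exp_def j_exp_def N_exp_def L_exp_def y_exp_def block_exp_def
  base_exp_def arcs_exp_def code_exp_def choose_exp_def merged_exp_def node_exp_def t_exp_def
  tail_exp_def head_exp_def source_exp_def target_exp_def next_exp_def verts_exp_def guard_exp_def

lemma bounded_exps:
  assumes "\<And>a x. a \<in> {0, 1, 2, 9} \<Longrightarrow> S a x \<le> Q" "2 \<le> Q" "e \<in> set exps"
  shows "bounded_exp Q S e"
proof -
  have k: "bounded_exp Q S k_exp" and n: "bounded_exp Q S n_exp" and j: "bounded_exp Q S j_exp"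
    using assms(1) by (simp_all add: k_exp_def n_exp_def j_exp_def)
  have N: "bounded_exp Q S N_exp" using k n by (simp add: N_exp_def)
  have L: "bounded_exp Q S L_exp" using N assms(2) by (simp add: L_exp_def)
  have y: "bounded_exp Q S y_exp" using j L by (simp add: y_exp_def)
  have block: "bounded_exp Q S block_exp" using y n by (simp add: block_exp_def)
  have base: "bounded_exp Q S base_exp" using block n by (simp add: base_exp_def)
  have arcs: "bounded_exp Q S arcs_exp" using N L by (simp add: arcs_exp_def)
  have t: "bounded_exp Q S t_exp" using j L by (simp add: t_exp_def)
  have code: "bounded_exp Q S (code_exp a b)" if "bounded_exp Q S a" "bounded_exp Q S b" for a b
    using that L assms(2) by (simp add: code_exp_def)
  have node: "bounded_exp Q S (node_exp t)" if "bounded_exp Q S t" for t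
    using that code base y n N L assms(1,2)
    by (simp add: node_exp_def choose_exp_def merged_exp_def)
  show ?thesis
    using assms(2,3) k n j N L y block base arcs code node t
    by (auto simp: exps_def tail_exp_def head_exp_def source_exp_def target_exp_def next_exp_def
        verts_exp_def guard_exp_def)
qed

section \<open>Constants for time and word length\<close>

fun straight_time :: "com \<Rightarrow> nat" where
  "straight_time (Put a i e) = acost i + acost e + 1"
| "straight_time (Seq c1 c2) = straight_time c1 + straight_time c2"
| "straight_time _ = 0"

text \<open>The store is bounded by \<open>2 * N * N\<close>, which is at most
  \<open>2 ^ (3 * floorlog 2 N)\<close>; the sum dominates every exponent and the final 1 makes the
  bound strict.\<close>

definition word_factor :: nat where
  "word_factor = 3 * sum_list (map size_exp exps) + 1"

text \<open>The loop has \<open>2 * N * N\<close> iterations; the summand 3 lets the same constant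
  bound the number of vertices.\<close>

definition time_factor :: nat where
  "time_factor = 2 * (acost guard_exp + 1 + straight_time loop_body) + (acost guard_exp + 1) +
     (1 + acost verts_exp + 1) + (1 + acost arcs_exp + 1) + 3"

section \<open>Correctness and running time of the program\<close>

context line_arrangement
begin

definition ready :: "nat \<Rightarrow> store \<Rightarrow> bool" where
  "ready j S \<longleftrightarrow> S 0 = (\<lambda>_. 0)(0 := k) \<and> S 1 = (\<lambda>_. 0)(0 := n) \<and>
     S 2 = (\<lambda>x. if x < N\<^sup>2 \<and> (x div N, x mod N) \<in> E then 1 else 0) \<and> S 9 = (\<lambda>_. 0)(0 := j)"

lemma ready_upd: "ready j S \<Longrightarrow> a \<notin> {0, 1, 2, 9} \<Longrightarrow> ready j (S(a := f))"
  by (simp add: ready_def)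

lemma fits_ready:
  assumes "ready j S" "j \<le> N * (2 * N)" "e \<in> set exps"
  shows "fits (word_factor * floorlog 2 N) e S"
proof (rule fits_if_bounded)
  have "k \<le> N" "n \<le> N" "N \<le> N * (2 * N)"
    using N_pos k_pos n_pos by (simp_all add: N_def)
  then have N: "k \<le> N * (2 * N)" "n \<le> N * (2 * N)"
    by (blast intro: order_trans)+
  have "1 * 2 \<le> N * (2 * N)"
    using N_pos by (intro mult_le_mono) simp_all
  then show "2 \<le> N * (2 * N)" by simp
  show "bounded_exp (N * (2 * N)) S e"
    using assms(1,2) N \<open>2 \<le> N * (2 * N)\<close> by (intro bounded_exps[OF _ _ assms(3)]) (auto simp: ready_def)
  let ?f = "floorlog 2 N"
  have "N < 2 ^ ?f"
    using floorlog_bounds[of N 2] N_pos by simp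
  then have "N * (2 * N) \<le> 2 ^ ?f * (2 * 2 ^ ?f)"
    by (intro mult_le_mono) simp_all
  also have "\<dots> = 2 ^ (2 * ?f + 1)"
    by (simp add: power_add mult_2 distrib_left)
  also have "\<dots> \<le> 2 ^ (3 * ?f)"
    using N_pos by (intro power_increasing) (simp_all add: floorlog_def)
  finally have "(N * (2 * N)) ^ size_exp e \<le> (2 ^ (3 * ?f)) ^ size_exp e"
    by (rule power_mono) simp
  also have "\<dots> = 2 ^ (3 * ?f * size_exp e)"
    by (simp only: power_mult)
  also have "\<dots> < 2 ^ (word_factor * ?f)"
  proof (rule power_strict_increasing)
    have "size_exp e \<le> sum_list (map size_exp exps)"
      using assms(3) by (intro member_le_sum_list) auto
    then have "3 * size_exp e < word_factor"
      by (simp add: word_factor_def)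
    moreover have "0 < ?f"
      using N_pos by (simp add: floorlog_def)
    ultimately have "3 * size_exp e * ?f < word_factor * ?f"
      by (rule mult_less_mono1)
    then show "3 * ?f * size_exp e < word_factor * ?f"
      by (simp add: ac_simps)
  qed simp
  finally show "(N * (2 * N)) ^ size_exp e < 2 ^ (word_factor * ?f)" .
qed

lemma aval_basic:
  assumes "ready j S"
  shows "aval j_exp S = j" "aval next_exp S = Suc j" "aval n_exp S = n" "aval N_exp S = N"
    "aval L_exp S = 2 * N" "aval arcs_exp S = N * (2 * N)" "aval guard_exp S = N * (2 * N) - j"
    "aval t_exp S = j mod (2 * N)" "aval y_exp S = j div (2 * N)"
    "aval block_exp S = j div (2 * N) div n" "aval base_exp S = base (j div (2 * N))"
    "aval (code_exp a b) S = code (aval a S) (aval b S)"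
    "aval source_exp S = code (base (j div (2 * N))) 0"
    "aval target_exp S = code (base (j div (2 * N))) (2 * N)"
    "aval verts_exp S = code N 0"
  using assms by (simp_all add: ready_def exp_defs N_def base_def code_def)

lemma aval_merged_exp:
  assumes "ready j S" "j < N * (2 * N)"
  shows "aval (merged_exp t) S = 0 \<longleftrightarrow> \<not> merged (j div (2 * N)) (aval t S)"
proof -
  let ?y = "j div (2 * N)" and ?t = "aval t S"
  have y: "?y < N"
    using assms(2) by (simp add: less_mult_imp_div_less)
  \<comment> \<open>Without this bound the second factor is zero and the entry is irrelevant; with
    it the index stays inside the matrix.\<close>
  have "S 2 ((?t - base ?y) * N + ?y) = (if (?t - base ?y, ?y) \<in> E then 1 else 0)"
    if "?t < 2 * base ?y"
  proof -
    have u: "?t - base ?y + 1 \<le> N"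
      using that base_le[of ?y] y by linarith
    have "(?t - base ?y + 1) * N \<le> N * N"
      using u by (rule mult_le_mono1)
    then have "(?t - base ?y) * N + ?y < N\<^sup>2"
      using y by (simp add: power2_eq_square)
    then show ?thesis
      using assms(1) y by (simp add: ready_def)
  qed
  then show ?thesis
    by (cases "base ?y \<le> ?t"; cases "?t < 2 * base ?y")
      (simp_all add: merged_exp_def merged_def aval_basic[OF assms(1)])
qed

lemma aval_node_exp:
  assumes "ready j S" "j < N * (2 * N)" "aval t S \<le> 2 * N"
  shows "aval (node_exp t) S = node (j div (2 * N)) (aval t S)"
  using assms(3) aval_basic[OF assms(1)] aval_merged_exp[OF assms(1,2)]
  by (auto simp: node_exp_def aval_choose_exp node_def)

definition loop_inv :: "nat \<Rightarrow> store \<Rightarrow> bool" where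
  "loop_inv j S \<longleftrightarrow> ready j S \<and> S 3 0 = N * (2 * N + 1) \<and> S 4 0 = N * (2 * N) \<and>
     (\<forall>x<j. S 5 x = node (x div (2 * N)) (x mod (2 * N)) \<and>
            S 6 x = node (x div (2 * N)) (Suc (x mod (2 * N))) \<and>
            S 7 (x div (2 * N) div n) = node (x div (2 * N) div n * n) 0 \<and>
            S 8 (x div (2 * N) div n) = node (x div (2 * N) div n * n) (2 * N))"

lemma exec_loop_body:
  assumes inv: "loop_inv j S" and j: "j < N * (2 * N)"
  shows "\<exists>S'. exec (word_factor * floorlog 2 N) loop_body S (straight_time loop_body) S' \<and>
    loop_inv (Suc j) S'"
proof -
  let ?w = "word_factor * floorlog 2 N" and ?y = "j div (2 * N)" and ?t = "j mod (2 * N)"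
  let ?b = "?y div n"
  define S1 where "S1 = S(5 := (S 5)(j := node ?y ?t))"
  define S2 where "S2 = S1(6 := (S1 6)(j := node ?y (Suc ?t)))"
  define S3 where "S3 = S2(7 := (S2 7)(?b := node (?b * n) 0))"
  define S4 where "S4 = S3(8 := (S3 8)(?b := node (?b * n) (2 * N)))"
  define S5 where "S5 = S4(9 := (S4 9)(0 := Suc j))"
  have r0: "ready j S" using inv by (simp add: loop_inv_def)
  have r1: "ready j S1" unfolding S1_def by (rule ready_upd[OF r0]) simp
  have r2: "ready j S2" unfolding S2_def by (rule ready_upd[OF r1]) simp
  have r3: "ready j S3" unfolding S3_def by (rule ready_upd[OF r2]) simp
  have r4: "ready j S4" unfolding S4_def by (rule ready_upd[OF r3]) simp
  have t: "?t < 2 * N" using N_pos by simp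
  have fits: "fits ?w e X" if "ready j X" "e \<in> set exps" for e X
    using fits_ready[OF that(1) _ that(2)] j by simp
  have put: "exec ?w (Put a i e) X (straight_time (Put a i e)) (X(a := (X a)(x := v)))"
    if "ready j X" "i \<in> set exps" "e \<in> set exps" "aval i X = x" "aval e X = v" for a i e X x v
    using exec.Put[OF fits[OF that(1,2)] fits[OF that(1,3)], of a] that(4,5) by simp
  have "aval tail_exp S = node ?y ?t"
    using aval_node_exp[OF r0 j, of t_exp] aval_basic[OF r0] t by (simp add: tail_exp_def)
  then have 1: "exec ?w (Put 5 j_exp tail_exp) S (straight_time (Put 5 j_exp tail_exp)) S1"
    unfolding S1_def by (intro put r0) (simp_all add: exps_def aval_basic[OF r0])
  have "aval head_exp S1 = node ?y (Suc ?t)"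
    using aval_node_exp[OF r1 j, of "Bop Add t_exp (Const 1)"] aval_basic[OF r1] t
    by (simp add: head_exp_def)
  then have 2: "exec ?w (Put 6 j_exp head_exp) S1 (straight_time (Put 6 j_exp head_exp)) S2"
    unfolding S2_def by (intro put r1) (simp_all add: exps_def aval_basic[OF r1])
  have 3: "exec ?w (Put 7 block_exp source_exp) S2 (straight_time (Put 7 block_exp source_exp)) S3"
    unfolding S3_def
    by (intro put r2) (simp_all add: exps_def aval_basic[OF r2] node_end base_mult base_def[of ?y])
  have 4: "exec ?w (Put 8 block_exp target_exp) S3 (straight_time (Put 8 block_exp target_exp)) S4"
    unfolding S4_def
    by (intro put r3) (simp_all add: exps_def aval_basic[OF r3] node_end base_mult base_def[of ?y])
  have 5: "exec ?w (Put 9 (Const 0) next_exp) S4 (straight_time (Put 9 (Const 0) next_exp)) S5"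
    unfolding S5_def by (intro put r4) (simp_all add: exps_def aval_basic[OF r4])
  have "exec ?w loop_body S (straight_time loop_body) S5"
    unfolding loop_body_def straight_time.simps(2) by (intro exec.Seq) (rule 1 2 3 4 5)+
  moreover have "loop_inv (Suc j) S5"
    using inv r4 unfolding S5_def S4_def S3_def S2_def S1_def
    by (auto simp: loop_inv_def ready_def less_Suc_eq)
  ultimately show ?thesis by blast
qed

lemma exec_reduction_prog:
  assumes "ready 0 S"
  shows "\<exists>T S'. exec (word_factor * floorlog 2 N) reduction_prog S T S' \<and> T \<le> time_factor * N\<^sup>2 \<and>
    loop_inv (N * (2 * N)) S'"
proof -
  let ?w = "word_factor * floorlog 2 N" and ?m = "N * (2 * N)"
  define S1 where "S1 = S(3 := (S 3)(0 := N * (2 * N + 1)))"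
  define S2 where "S2 = S1(4 := (S1 4)(0 := ?m))"
  have r1: "ready 0 S1" unfolding S1_def by (rule ready_upd[OF assms]) simp
  have r2: "ready 0 S2" unfolding S2_def by (rule ready_upd[OF r1]) simp
  have fits: "fits ?w e X" if "ready j X" "j \<le> ?m" "e \<in> set exps" for e X j
    using fits_ready[OF that] .
  have 1: "exec ?w (Put 3 (Const 0) verts_exp) S (1 + acost verts_exp + 1) S1"
    using exec.Put[OF fits[OF assms] fits[OF assms], of "Const 0" verts_exp 3]
    by (simp add: exps_def aval_basic[OF assms] code_def S1_def)
  have 2: "exec ?w (Put 4 (Const 0) arcs_exp) S1 (1 + acost arcs_exp + 1) S2"
    using exec.Put[OF fits[OF r1] fits[OF r1], of "Const 0" arcs_exp 4]
    by (simp add: exps_def aval_basic[OF r1] S2_def)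
  obtain S' where S': "exec ?w (While guard_exp loop_body) S2
      (?m * (acost guard_exp + 1 + straight_time loop_body) + (acost guard_exp + 1)) S'" "loop_inv ?m S'"
  proof -
    have "fits ?w guard_exp X \<and> (aval guard_exp X = 0 \<longleftrightarrow> j = ?m)" if "loop_inv j X" "j \<le> ?m" for j X
      using that fits[of j X guard_exp] aval_basic(7)[of j X]
      by (auto simp: loop_inv_def exps_def)
    moreover have "loop_inv 0 S2"
      using r2 by (simp add: loop_inv_def S2_def S1_def)
    ultimately show ?thesis
      using that exec_While_count[where I = loop_inv and m = ?m, OF _ exec_loop_body] by blast
  qed
  define T where "T = 1 + acost verts_exp + 1 + (1 + acost arcs_exp + 1 +
    (?m * (acost guard_exp + 1 + straight_time loop_body) + (acost guard_exp + 1)))"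
  have "exec ?w reduction_prog S T S'"
    unfolding reduction_prog_def T_def by (intro exec.Seq) (rule 1 2 S'(1))+
  moreover have "T \<le> time_factor * N\<^sup>2"
  proof -
    define g where "g = acost guard_exp + 1 + straight_time loop_body"
    define r where "r = acost guard_exp + 1 + (1 + acost verts_exp + 1) + (1 + acost arcs_exp + 1)"
    have "T = 2 * g * N\<^sup>2 + r"
      by (simp add: T_def g_def r_def power2_eq_square)
    also have "\<dots> \<le> 2 * g * N\<^sup>2 + r * N\<^sup>2"
      using N_pos by simp
    also have "\<dots> \<le> (2 * g + r + 3) * N\<^sup>2"
      by (simp add: add_mult_distrib)
    also have "2 * g + r + 3 = time_factor"
      by (simp add: g_def r_def time_factor_def)
    finally show ?thesis .
  qed
  ultimately show ?thesis
    using S'(2) by blast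
qed

lemma dsp_output_grid:
  assumes "loop_inv (N * (2 * N)) S"
  shows "dsp_output k S grid (\<lambda>i. node (i * n) 0) (\<lambda>i. node (i * n) (2 * N))"
proof -
  let ?m = "N * (2 * N)"
  have index: "y * (2 * N) + \<tau> < ?m" "(y * (2 * N) + \<tau>) div (2 * N) = y" "(y * (2 * N) + \<tau>) mod (2 * N) = \<tau>"
    if "y < N" "\<tau> < 2 * N" for y \<tau>
  proof -
    have "(y + 1) * (2 * N) \<le> ?m"
      using that(1) by (intro mult_le_mono1) simp
    then show "y * (2 * N) + \<tau> < ?m" using that(2) by simp
  qed (use that in simp_all)
  have "parcs grid = (\<lambda>x. (S 5 x, S 6 x)) ` {..<?m}"
  proof (intro equalityI subsetI)
    fix e assume "e \<in> parcs grid"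
    then obtain y \<tau> where e: "e = (node y \<tau>, node y (Suc \<tau>))" "y < N" "\<tau> < 2 * N"
      by (auto simp: parcs_grid)
    then show "e \<in> (\<lambda>x. (S 5 x, S 6 x)) ` {..<?m}"
      using index[OF e(2,3)] assms unfolding loop_inv_def
      by (intro image_eqI[of _ _ "y * (2 * N) + \<tau>"]) simp_all
  next
    fix e assume "e \<in> (\<lambda>x. (S 5 x, S 6 x)) ` {..<?m}"
    then obtain x where x: "x < ?m" "e = (S 5 x, S 6 x)" by auto
    then have "e = (node (x div (2 * N)) (x mod (2 * N)), node (x div (2 * N)) (Suc (x mod (2 * N))))"
      using assms by (simp add: loop_inv_def)
    moreover have "x div (2 * N) < N" "x mod (2 * N) < 2 * N"
      using x(1) N_pos by (simp_all add: less_mult_imp_div_less)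
    ultimately show "e \<in> parcs grid"
      unfolding parcs_grid by blast
  qed
  moreover have "node (i * n) 0 = S 7 i \<and> node (i * n) (2 * N) = S 8 i" if "i < k" for i
  proof -
    have "i * n < N" using that n_pos by (simp add: N_def)
    \<comment> \<open>The first arc of line \<open>i * n\<close> belongs to block \<open>i\<close>,
      so its iteration has written the terminals of part \<open>i\<close>.\<close>
    then have x: "i * n * (2 * N) < ?m" "i * n * (2 * N) div (2 * N) div n = i"
      using index[of "i * n" 0] N_pos n_pos by simp_all
    have "S 7 (x div (2 * N) div n) = node (x div (2 * N) div n * n) 0 \<and>
        S 8 (x div (2 * N) div n) = node (x div (2 * N) div n * n) (2 * N)" if "x < ?m" for x
      using that assms by (simp add: loop_inv_def)
    from this[OF x(1)] show ?thesis
      unfolding x(2) by simp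
  qed
  ultimately show ?thesis
    using assms by (simp add: dsp_output_def loop_inv_def pverts_grid)
qed

end

theorem theorem7:
  shows "\<exists>C d :: nat. \<forall>k \<ge> 1. \<exists>prog. \<forall>n \<ge> 1. \<forall>G. kpartite_graph k n G \<longrightarrow>
    (\<exists>T S H s t.
       exec (d * floorlog 2 (k * n)) prog (clique_input k n G) T S \<and>
       T \<le> C * (k * n)\<^sup>2 \<and>
       dsp_output k S H s t \<and>
       dag H \<and>
       (\<forall>i<k. s i \<in> pverts H \<and> t i \<in> pverts H) \<and>
       card (pverts H) \<le> C * (k * n)\<^sup>2 \<and>
       (has_clique G k \<longleftrightarrow>
          wf_digraph.disjoint_shortest_paths (with_proj H) (\<lambda>_. 1) k s t))"
proof (rule exI[of _ time_factor], rule exI[of _ word_factor], intro allI impI,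
    rule exI[of _ reduction_prog], intro allI impI)
  \<comment> \<open>The program reads \<open>k\<close> from its input, so neither it nor the two
    constants depend on \<open>k\<close>.\<close>
  fix k n :: nat and G :: "nat pair_pre_digraph"
  assume k: "1 \<le> k" and n: "1 \<le> n" and G: "kpartite_graph k n G"
  interpret line_arrangement k n "parcs G"
    using k n by unfold_locales
  have "sym (parcs G)"
    using G unfolding kpartite_graph_def
    by (metis pair_graph.axioms(2) pair_pseudo_graph.axioms(2) pair_sym_digraph.pair_sym_arcs
        symmetric_def with_proj_simps(3))
  have "ready 0 (clique_input k n G)"
    by (auto simp: ready_def clique_input_def N_def fun_eq_iff)
  then obtain T S where TS: "exec (word_factor * floorlog 2 (k * n)) reduction_prog
      (clique_input k n G) T S"
    "T \<le> time_factor * (k * n)\<^sup>2" "loop_inv (N * (2 * N)) S"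
    using exec_reduction_prog unfolding N_def by blast
  let ?s = "\<lambda>i. node (i * n) 0" and ?t = "\<lambda>i. node (i * n) (2 * N)"
  have "?s i \<in> pverts grid \<and> ?t i \<in> pverts grid" if "i < k" for i
    using node_less[of "i * n"] that n by (simp add: pverts_grid N_def)
  moreover have "card (pverts grid) \<le> time_factor * (k * n)\<^sup>2"
  proof -
    have "N * (2 * N + 1) \<le> 3 * N\<^sup>2"
      using N_pos by (simp add: power2_eq_square)
    also have "\<dots> \<le> time_factor * N\<^sup>2"
      by (intro mult_le_mono1) (simp add: time_factor_def)
    finally show ?thesis by (simp add: pverts_grid N_def)
  qed
  moreover have "has_clique G k \<longleftrightarrow> disjoint_shortest_paths (\<lambda>_. 1) k ?s ?t"
    using has_clique_iff_transversal[OF G n] disjoint_shortest_paths_iff[OF \<open>sym (parcs G)\<close>]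
    by (simp add: N_def)
  ultimately show "\<exists>T S H s t.
       exec (word_factor * floorlog 2 (k * n)) reduction_prog (clique_input k n G) T S \<and>
       T \<le> time_factor * (k * n)\<^sup>2 \<and> dsp_output k S H s t \<and> dag H \<and>
       (\<forall>i<k. s i \<in> pverts H \<and> t i \<in> pverts H) \<and>
       card (pverts H) \<le> time_factor * (k * n)\<^sup>2 \<and>
       (has_clique G k \<longleftrightarrow> wf_digraph.disjoint_shortest_paths (with_proj H) (\<lambda>_. 1) k s t)"
    using TS(1,2) dsp_output_grid[OF TS(3)] dag_grid by blast
qed

end
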